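(* Let $\beta=(\beta_x,\beta_y)$ and $\gamma=(\gamma_x,\gamma_y)$ be pairs of positive real numbers. The function $F^*_{\beta,M}:\mathcal Z\to\mathbb R$ is 1-weakly convex in the norm $\|\cdot\|_\beta$ (that is, $z\mapsto F^*_{\beta,M}(z)+\frac12\|z\|_\beta^2$ is convex) and differentiable. If we denote $$\bar z_\beta(z)=\arg\min_{z'\in\mathcal Z}\; F(z')-\langle Mz,z'\rangle+\frac12\|z'-z\|_\beta^2,$$ then the gradient of $F^*_{\beta,M}$ is given by $$\nabla F^*_{\beta,M}(z)=-M\bar z_\beta(z)+\beta.(\bar z_\beta(z)-z),$$ and it is $L_{\beta,\gamma}$-Lipschitz in the norm $\|\cdot\|_{\gamma^{-1}}$, that is, $\|\nabla F^*_{\beta,M}(z_1)-\nabla F^*_{\beta,M}(z_2)\|_\gamma\le L_{\beta,\gamma}\|z_1-z_2\|_{\gamma^{-1}}$ for all $z_1,z_2\in\mathcal Z$, with $$L_{\beta,\gamma}=\max\Big(\beta_x\gamma_x+\frac{\gamma_x}{\beta_y}\|A\|^2,\ \beta_y\gamma_y+\frac{\gamma_y}{\beta_x}\|A\|^2\Big)+\max(\beta_x\gamma_x,\beta_y\gamma_y).$$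
   Context: Let $\mathcal X=\mathbb R^n$, $\mathcal Y=\mathbb R^m$, $\mathcal Z=\mathcal X\times\mathcal Y$ with the Euclidean inner product. Let $f:\mathcal X\to\mathbb R\cup\{+\infty\}$ and $g:\mathcal Y\to\mathbb R\cup\{+\infty\}$ be proper lower semicontinuous convex functions, $g^*$ the Fenchel conjugate of $g$, and $A:\mathcal X\to\mathcal Y$ a linear operator with operator norm $\|A\|$. It is assumed that the set $\mathcal Z_*$ of saddle points of $\min_x\max_y f(x)+\langle Ax,y\rangle-g^*(y)$ is not empty. For $z=(x,y)\in\mathcal Z$ put $F(z)=f(x)+g^*(y)$ and $Mz=(-A^\top y,Ax)$. For a pair $\beta=(\beta_x,\beta_y)$ of positive reals: $\beta.z=(\beta_x x,\beta_y y)$, $\|z\|_\beta^2=\beta_x\|x\|^2+\beta_y\|y\|^2$, $\beta^{-1}=(\beta_x^{-1},\beta_y^{-1})$. The function $F^*_{\beta,M}$ is defined by $$F^*_{\beta,M}(z)=\sup_{z'\in\mathcal Z}\ \langle Mz,z'\rangle-F(z')-\frac12\|z-z'\|_\beta^2 .$$ Gradients are taken with respect to the Euclidean inner product, and $\|\cdot\|_\gamma$ is the norm dual to $\|\cdot\|_{\gamma^{-1}}$. *)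

theory Defs
  imports "HOL-Analysis.Analysis"
begin

section \<open>Extended-real-valued convex functions\<close>

definition proper :: "('a \<Rightarrow> ereal) \<Rightarrow> bool" where
  "proper f \<longleftrightarrow> (\<forall>x. f x \<noteq> -\<infinity>) \<and> (\<exists>x. f x \<noteq> \<infinity>)"

definition lsc :: "('a::topological_space \<Rightarrow> ereal) \<Rightarrow> bool" where
  "lsc f \<longleftrightarrow> (\<forall>x. f x \<le> Liminf (at x) f)"

(* Analogue of convex_on UNIV, which is only available for real-valued functions. *)
definition convex_ereal :: "('a::real_vector \<Rightarrow> ereal) \<Rightarrow> bool" where
  "convex_ereal f \<longleftrightarrow>
     (\<forall>x y. \<forall>u>0. \<forall>v>0. u + v = 1 \<longrightarrow>
        f (u *\<^sub>R x + v *\<^sub>R y) \<le> ereal u * f x + ereal v * f y)"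

definition fenchel_conjugate :: "('a::real_inner \<Rightarrow> ereal) \<Rightarrow> 'a \<Rightarrow> ereal" where
  "fenchel_conjugate g y = (SUP v. ereal (v \<bullet> y) - g v)"

text \<open>The value is meaningful only where \<open>h\<close> is differentiable.\<close>

definition gradient :: "('a::real_inner \<Rightarrow> real) \<Rightarrow> 'a \<Rightarrow> 'a" where
  "gradient h z = (THE d. GDERIV h z :> d)"


section \<open>The saddle point problem\<close>

definition lagrangian ::
  "('a \<Rightarrow> ereal) \<Rightarrow> ('b::real_inner \<Rightarrow> ereal) \<Rightarrow> ('a \<Rightarrow> 'b) \<Rightarrow> 'a \<Rightarrow> 'b \<Rightarrow> ereal" where
  "lagrangian f g A x y = f x + ereal (A x \<bullet> y) - fenchel_conjugate g y"

text \<open>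
  Restricting to the domains of \<open>f\<close> and of the conjugate of \<open>g\<close> means that none of the
  values compared below is of the form \<open>\<infinity> - \<infinity>\<close> when \<open>f\<close> and \<open>g\<close> are proper.
\<close>

definition saddle_points ::
  "('a \<Rightarrow> ereal) \<Rightarrow> ('b::real_inner \<Rightarrow> ereal) \<Rightarrow> ('a \<Rightarrow> 'b) \<Rightarrow> ('a \<times> 'b) set" where
  "saddle_points f g A =
     {(x, y). f x \<noteq> \<infinity> \<and> fenchel_conjugate g y \<noteq> \<infinity> \<and>
        (\<forall>y'. lagrangian f g A x y' \<le> lagrangian f g A x y) \<and>
        (\<forall>x'. lagrangian f g A x y \<le> lagrangian f g A x' y)}"

definition F_sum ::
  "('a \<Rightarrow> ereal) \<Rightarrow> ('b::real_inner \<Rightarrow> ereal) \<Rightarrow> 'a \<times> 'b \<Rightarrow> ereal" where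
  "F_sum f g z = f (fst z) + fenchel_conjugate g (snd z)"

definition M_op ::
  "('a::real_inner \<Rightarrow> 'b::real_inner) \<Rightarrow> 'a \<times> 'b \<Rightarrow> 'a \<times> 'b" where
  "M_op A z = (- adjoint A (snd z), A (fst z))"


section \<open>Weights\<close>

definition wscale ::
  "real \<times> real \<Rightarrow> 'a::real_vector \<times> 'b::real_vector \<Rightarrow> 'a \<times> 'b" where
  "wscale \<beta> z = (fst \<beta> *\<^sub>R fst z, snd \<beta> *\<^sub>R snd z)"

definition wnorm ::
  "real \<times> real \<Rightarrow> 'a::real_normed_vector \<times> 'b::real_normed_vector \<Rightarrow> real" where
  "wnorm \<beta> z = sqrt (fst \<beta> * (norm (fst z))\<^sup>2 + snd \<beta> * (norm (snd z))\<^sup>2)"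

definition winv :: "real \<times> real \<Rightarrow> real \<times> real" where
  "winv \<beta> = (inverse (fst \<beta>), inverse (snd \<beta>))"

definition weakly_convex1 ::
  "real \<times> real \<Rightarrow> ('a::real_normed_vector \<times> 'b::real_normed_vector \<Rightarrow> real) \<Rightarrow> bool" where
  "weakly_convex1 \<beta> h \<longleftrightarrow> convex_on UNIV (\<lambda>z. h z + 1/2 * (wnorm \<beta> z)\<^sup>2)"


section \<open>The smoothed function and its minimizer\<close>

definition F_star ::
  "('a::real_inner \<Rightarrow> ereal) \<Rightarrow> ('b::real_inner \<Rightarrow> ereal) \<Rightarrow> ('a \<Rightarrow> 'b) \<Rightarrow> real \<times> real
     \<Rightarrow> 'a \<times> 'b \<Rightarrow> ereal" where
  "F_star f g A \<beta> z =
     (SUP z'. ereal (M_op A z \<bullet> z') - F_sum f g z' - ereal (1/2 * (wnorm \<beta> (z - z'))\<^sup>2))"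

definition zbar_objective ::
  "('a::real_inner \<Rightarrow> ereal) \<Rightarrow> ('b::real_inner \<Rightarrow> ereal) \<Rightarrow> ('a \<Rightarrow> 'b) \<Rightarrow> real \<times> real
     \<Rightarrow> 'a \<times> 'b \<Rightarrow> 'a \<times> 'b \<Rightarrow> ereal" where
  "zbar_objective f g A \<beta> z z' =
     F_sum f g z' - ereal (M_op A z \<bullet> z') + ereal (1/2 * (wnorm \<beta> (z' - z))\<^sup>2)"

definition zbar ::
  "('a::real_inner \<Rightarrow> ereal) \<Rightarrow> ('b::real_inner \<Rightarrow> ereal) \<Rightarrow> ('a \<Rightarrow> 'b) \<Rightarrow> real \<times> real
     \<Rightarrow> 'a \<times> 'b \<Rightarrow> 'a \<times> 'b" where
  "zbar f g A \<beta> z = arg_min (zbar_objective f g A \<beta> z) (\<lambda>_. True)"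

definition L_const ::
  "('a::real_normed_vector \<Rightarrow> 'b::real_normed_vector) \<Rightarrow> real \<times> real \<Rightarrow> real \<times> real \<Rightarrow> real" where
  "L_const A \<beta> \<gamma> =
     max (fst \<beta> * fst \<gamma> + fst \<gamma> / snd \<beta> * (onorm A)\<^sup>2)
         (snd \<beta> * snd \<gamma> + snd \<gamma> / fst \<beta> * (onorm A)\<^sup>2)
     + max (fst \<beta> * fst \<gamma>) (snd \<beta> * snd \<gamma>)"

end

(* Completing the square gives F*_{beta,M}(z) = H((M + beta) z) - |z|_beta^2 / 2, where H is the
   conjugate of the strongly convex function F + |.|_beta^2 / 2. Hence H is convex and differentiable,
   its gradient at w is the minimizer p(w) of F + |.|_beta^2 / 2 - <w, .>, and
   |p(w) - p(w')|_beta^2 <= <w - w', p(w) - p(w')>. The gradient of F*_{beta,M} at z is therefore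
   (beta - M) p((M + beta) z) - beta z. The first maximum in the Lipschitz constant is the product of
   the norms of beta + M and of its adjoint beta - M, the second is the norm of beta. *)

theory Submission
  imports Defs
begin

section \<open>Quadratic regularisation of a closed convex function\<close>

text \<open>\<open>F\<close> takes the value \<infinity>, so it enters as a real function
  \<open>r\<close> on its domain \<open>D\<close>, by way of convexity, a closed epigraph and an
  affine minorant; this keeps infinite values out of the minimization. The modulus
  \<open>\<mu>\<close> compares \<open>B\<close> with the Euclidean norm and serves existence,
  uniqueness and differentiability. It stays out of the Lipschitz constant: there the monotonicity
  inequality is used with the form \<open>B\<close> itself, which makes the minimizer 1-Lipschitz
  from \<open>wnorm (winv \<beta>)\<close> to \<open>wnorm \<beta>\<close>. The part of the gradient
  that contains the minimizer thus factors through the norms \<open>winv \<gamma>\<close>,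
  \<open>winv \<beta>\<close>, \<open>\<beta>\<close>, \<open>\<gamma>\<close> in this order. The
  two outer maps are adjoint to each other, hence share one bound, the square root of the first
  maximum.\<close>

locale quadratic_regularisation =
  fixes D :: "'a::{real_inner,complete_space} set"
    and r :: "'a \<Rightarrow> real"
    and B :: "'a \<Rightarrow> 'a"
    and \<mu> :: real
  assumes nonempty: "D \<noteq> {}"
    and convex_r: "convex_on D r"
    and closed_epigraph: "closed (epigraph D r)"
    and minorant: "\<exists>a b. \<forall>z\<in>D. a \<bullet> z + b \<le> r z"
    and linear_B: "bounded_linear B"
    and symmetric_B: "B x \<bullet> y = x \<bullet> B y"
    and mu_pos: "\<mu> > 0"
    and coercive: "\<mu> * (norm x)\<^sup>2 \<le> B x \<bullet> x"
begin

definition tilted :: "'a \<Rightarrow> 'a \<Rightarrow> real" where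
  "tilted w z = r z + B z \<bullet> z / 2 - w \<bullet> z"

lemma B_add: "B (x + y) = B x + B y" and B_diff: "B (x - y) = B x - B y"
  and B_scaleR: "B (t *\<^sub>R x) = t *\<^sub>R B x"
  using linear_B by (simp_all add: linear_simps)

text \<open>The linear term is affine and \<open>r\<close> is convex, while a quadratic form
  satisfies this relation with equality; the whole gain therefore comes from
  \<open>B\<close>.\<close>

lemma tilted_strongly_convex:
  assumes "x \<in> D" "y \<in> D" "0 \<le> t" "t \<le> 1"
  shows "(1 - t) *\<^sub>R x + t *\<^sub>R y \<in> D"
    and "tilted w ((1 - t) *\<^sub>R x + t *\<^sub>R y)
      \<le> (1 - t) * tilted w x + t * tilted w y - t * (1 - t) / 2 * (B (x - y) \<bullet> (x - y))"
proof -
  show "(1 - t) *\<^sub>R x + t *\<^sub>R y \<in> D"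
    using assms convex_on_imp_convex[OF convex_r] by (simp add: convex_def)
  have r: "r ((1 - t) *\<^sub>R x + t *\<^sub>R y) \<le> (1 - t) * r x + t * r y"
    using convex_onD[OF convex_r, of t x y] assms by simp
  have c: "B y \<bullet> x = B x \<bullet> y" by (metis inner_commute symmetric_B)
  have "B ((1 - t) *\<^sub>R x + t *\<^sub>R y) \<bullet> ((1 - t) *\<^sub>R x + t *\<^sub>R y)
     = (1 - t)\<^sup>2 * (B x \<bullet> x) + 2 * (t * (1 - t)) * (B x \<bullet> y) + t\<^sup>2 * (B y \<bullet> y)"
    unfolding B_add B_scaleR inner_add_left inner_add_right inner_scaleR_left inner_scaleR_right c
    by (simp add: power2_eq_square algebra_simps)
  also have "\<dots> = (1 - t) * (B x \<bullet> x) + t * (B y \<bullet> y) - t * (1 - t) * (B (x - y) \<bullet> (x - y))"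
    unfolding B_diff inner_diff_left inner_diff_right c by (simp add: power2_eq_square algebra_simps)
  finally have q: "B ((1 - t) *\<^sub>R x + t *\<^sub>R y) \<bullet> ((1 - t) *\<^sub>R x + t *\<^sub>R y) = \<dots>" .
  show "tilted w ((1 - t) *\<^sub>R x + t *\<^sub>R y)
      \<le> (1 - t) * tilted w x + t * tilted w y - t * (1 - t) / 2 * (B (x - y) \<bullet> (x - y))"
    unfolding tilted_def q using r by (simp add: inner_add_right algebra_simps add_divide_distrib diff_divide_distrib)
qed

section \<open>Existence of the minimizer by completeness\<close>

lemma bdd_below_tilted: "bdd_below (tilted w ` D)"
proof -
  obtain a b where ab: "\<And>z. z \<in> D \<Longrightarrow> a \<bullet> z + b \<le> r z"
    using minorant by blast
  \<comment> \<open>With s = \<open>norm z\<close>, minorant and coercivity leave \<open>b\<close>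
    plus \<mu> s^2 / 2 - \<open>norm (a - w)\<close> s, whose minimum over s is this
    constant.\<close>
  have "b - (norm (a - w))\<^sup>2 / (2 * \<mu>) \<le> tilted w z" if "z \<in> D" for z
  proof -
    have "- (norm (a - w) * norm z) \<le> (a - w) \<bullet> z"
      using Cauchy_Schwarz_ineq2[of "a - w" z] by linarith
    moreover have "0 \<le> (norm (a - w) - \<mu> * norm z)\<^sup>2 / (2 * \<mu>)"
      using mu_pos by simp
    moreover have "(norm (a - w) - \<mu> * norm z)\<^sup>2 / (2 * \<mu>)
        = (norm (a - w))\<^sup>2 / (2 * \<mu>) - norm (a - w) * norm z + \<mu> * (norm z)\<^sup>2 / 2"
      using mu_pos by (simp add: power2_diff field_simps power2_eq_square)
    ultimately show ?thesis
      unfolding tilted_def using ab[OF that] coercive[of z] by (simp add: inner_diff_left)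
  qed
  then show ?thesis by (intro bdd_belowI2)
qed

text \<open>The midpoint of two almost minimal points cannot go below the infimum, so the gain from
  strong convexity there, and with it their distance, is small.\<close>

lemma minimizing_sequence_Cauchy:
  assumes X: "\<And>k. X k \<in> D" and lim: "(\<lambda>k. tilted w (X k)) \<longlonglongrightarrow> Inf (tilted w ` D)"
  shows "Cauchy X"
proof (rule metric_CauchyI)
  let ?m = "Inf (tilted w ` D)"
  fix e :: real assume "e > 0"
  \<comment> \<open>At t = 1/2 the gain factor t (1 - t) / 2 is 1/8, and coercivity contributes
    \<open>\<mu>\<close>.\<close>
  define d where "d = \<mu> * e\<^sup>2 / 8"
  have "d > 0" using \<open>e > 0\<close> mu_pos by (simp add: d_def)
  then obtain N where N: "\<And>k. k \<ge> N \<Longrightarrow> tilted w (X k) < ?m + d"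
    using order_tendstoD(2)[OF lim, of "?m + d"] by (auto simp: eventually_sequentially)
  show "\<exists>N. \<forall>j\<ge>N. \<forall>k\<ge>N. dist (X j) (X k) < e"
  proof (intro exI allI impI)
    fix j k assume jk: "j \<ge> N" "k \<ge> N"
    have "?m \<le> tilted w ((1 - 1/2) *\<^sub>R X j + (1/2) *\<^sub>R X k)"
      using tilted_strongly_convex(1)[OF X X, of "1/2"] by (intro cINF_lower bdd_below_tilted) auto
    also have "\<dots> \<le> tilted w (X j) / 2 + tilted w (X k) / 2 - B (X j - X k) \<bullet> (X j - X k) / 8"
      using tilted_strongly_convex(2)[OF X X, of "1/2" w j k] by simp
    finally have "B (X j - X k) \<bullet> (X j - X k) / 8 < d"
      using N[OF jk(1)] N[OF jk(2)] by linarith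
    then have "\<mu> * (norm (X j - X k))\<^sup>2 < \<mu> * e\<^sup>2"
      using coercive[of "X j - X k"] by (simp add: d_def)
    then show "dist (X j) (X k) < e"
      using mu_pos \<open>e > 0\<close> by (simp add: dist_norm power_less_imp_less_base)
  qed
qed

lemma minimizer_exists: "\<exists>p\<in>D. \<forall>z\<in>D. tilted w p \<le> tilted w z"
proof -
  let ?m = "Inf (tilted w ` D)"
  have "\<exists>x\<in>D. tilted w x < ?m + inverse (real (Suc k))" for k
    using cInf_lessD[of "tilted w ` D" "?m + inverse (real (Suc k))"] nonempty by auto
  then obtain X where X: "\<And>k. X k \<in> D" and lt: "\<And>k. tilted w (X k) < ?m + inverse (real (Suc k))"
    by metis
  have ge: "?m \<le> tilted w z" if "z \<in> D" for z
    using that by (intro cINF_lower bdd_below_tilted)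
  have up: "(\<lambda>k. ?m + inverse (real (Suc k))) \<longlonglongrightarrow> ?m"
    using tendsto_add[OF tendsto_const[of ?m] LIMSEQ_inverse_real_of_nat] by simp
  have lim: "(\<lambda>k. tilted w (X k)) \<longlonglongrightarrow> ?m"
    by (rule tendsto_sandwich[OF _ _ tendsto_const up])
      (auto intro: always_eventually ge X less_imp_le[OF lt] simp del: of_nat_Suc)
  obtain p where p: "X \<longlonglongrightarrow> p"
    using Cauchy_convergent[OF minimizing_sequence_Cauchy[OF X lim]] by (auto simp: convergent_def)
  have BX: "(\<lambda>k. B (X k)) \<longlonglongrightarrow> B p"
    using bounded_linear.tendsto[OF linear_B p] .
  \<comment> \<open>The sequence is \<open>r (X k)\<close>. Its limit follows from that of the
    tilted values, without continuity of \<open>r\<close>; the closed epigraph then puts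
    \<open>p\<close> into \<open>D\<close> and bounds \<open>r p\<close>.\<close>
  have "(\<lambda>k. tilted w (X k) - B (X k) \<bullet> X k / 2 + w \<bullet> X k) \<longlonglongrightarrow> ?m - B p \<bullet> p / 2 + w \<bullet> p"
    by (intro tendsto_intros lim p BX) simp
  then have Xr: "(\<lambda>k. (X k, r (X k))) \<longlonglongrightarrow> (p, ?m - B p \<bullet> p / 2 + w \<bullet> p)"
    by (intro tendsto_Pair p) (simp add: tilted_def)
  have "(X k, r (X k)) \<in> epigraph D r" for k
    using X by (simp add: mem_epigraph)
  then have "(p, ?m - B p \<bullet> p / 2 + w \<bullet> p) \<in> epigraph D r"
    by (rule closed_sequentially[OF closed_epigraph _ Xr])
  then have "p \<in> D" "tilted w p \<le> ?m"
    by (simp_all add: mem_epigraph tilted_def)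
  then show ?thesis by (metis ge order_trans)
qed

section \<open>The minimizer as a function of the tilt\<close>

definition argmin :: "'a \<Rightarrow> 'a" where
  "argmin w = (SOME p. p \<in> D \<and> (\<forall>z\<in>D. tilted w p \<le> tilted w z))"

lemma argmin_in: "argmin w \<in> D"
  and argmin_le: "z \<in> D \<Longrightarrow> tilted w (argmin w) \<le> tilted w z"
proof -
  have "\<exists>p. p \<in> D \<and> (\<forall>z\<in>D. tilted w p \<le> tilted w z)"
    using minimizer_exists[of w] by blast
  then have "argmin w \<in> D \<and> (\<forall>z\<in>D. tilted w (argmin w) \<le> tilted w z)"
    unfolding argmin_def by (rule someI_ex)
  then show "argmin w \<in> D" "z \<in> D \<Longrightarrow> tilted w (argmin w) \<le> tilted w z" by auto
qed

text \<open>Minimality is tested on the segment from the minimizer to \<open>z\<close>; dividing by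
  t and letting t tend to 0 recovers the full factor 1/2, which a fixed t would lose.\<close>

lemma quadratic_growth:
  assumes z: "z \<in> D"
  shows "tilted w (argmin w) + B (argmin w - z) \<bullet> (argmin w - z) / 2 \<le> tilted w z"
proof -
  let ?p = "argmin w" and ?Q = "B (argmin w - z) \<bullet> (argmin w - z)"
  have *: "(1 - t) / 2 * ?Q \<le> tilted w z - tilted w ?p" if "0 < t" "t < 1" for t
  proof -
    have "tilted w ?p \<le> tilted w ((1 - t) *\<^sub>R ?p + t *\<^sub>R z)"
      using that tilted_strongly_convex(1)[OF argmin_in z, of t] by (intro argmin_le) auto
    also have "\<dots> \<le> (1 - t) * tilted w ?p + t * tilted w z - t * (1 - t) / 2 * ?Q"
      using that by (intro tilted_strongly_convex(2) argmin_in z) auto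
    finally have "t * ((1 - t) / 2 * ?Q) \<le> t * (tilted w z - tilted w ?p)"
      by (simp add: algebra_simps)
    then show ?thesis using that by simp
  qed
  have "(1 - 0) / 2 * ?Q \<le> tilted w z - tilted w ?p"
  proof (rule tendsto_upperbound)
    show "((\<lambda>t. (1 - t) / 2 * ?Q) \<longlongrightarrow> (1 - 0) / 2 * ?Q) (at_right 0)"
      by (intro tendsto_intros) auto
    show "\<forall>\<^sub>F t in at_right 0. (1 - t) / 2 * ?Q \<le> tilted w z - tilted w ?p"
      unfolding eventually_at_right_field using * by (intro exI[of _ 1]) auto
  qed simp
  then show ?thesis by simp
qed

lemma argmin_unique:
  assumes "z \<in> D" "tilted w z \<le> tilted w (argmin w)"
  shows "z = argmin w"
proof -
  have "\<mu> * (norm (argmin w - z))\<^sup>2 \<le> 0"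
    using quadratic_growth[OF assms(1), of w] assms(2) coercive[of "argmin w - z"] by linarith
  then show ?thesis using mu_pos by (simp add: mult_le_0_iff)
qed

text \<open>Each minimizer is a competitor in the other problem. When the two growth inequalities
  are added, the values of \<open>r\<close> and the quadratic terms cancel, and the two halves of
  the gain add up to a constant of exactly 1.\<close>

lemma argmin_monotone:
  "B (argmin w - argmin w') \<bullet> (argmin w - argmin w') \<le> (w - w') \<bullet> (argmin w - argmin w')"
proof -
  have "B (argmin w' - argmin w) \<bullet> (argmin w' - argmin w) = B (argmin w - argmin w') \<bullet> (argmin w - argmin w')"
    by (simp add: B_diff inner_diff_left inner_diff_right)
  then show ?thesis
    using quadratic_growth[OF argmin_in, of w w'] quadratic_growth[OF argmin_in, of w' w]
    unfolding tilted_def inner_diff_left[of w w'] inner_diff_right[of w] inner_diff_right[of w']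
    by linarith
qed

section \<open>The conjugate as an attained supremum: convexity and gradient\<close>

definition conjugate :: "'a \<Rightarrow> real" where
  "conjugate w = - tilted w (argmin w)"

lemma conjugate_ge: "z \<in> D \<Longrightarrow> - tilted w z \<le> conjugate w"
  by (simp add: conjugate_def argmin_le)

text \<open>For a fixed point \<open>p\<close> the value \<open>- tilted w p\<close> is affine in
  \<open>w\<close>; taking \<open>p\<close> optimal for the combination turns the left side into
  such a value.\<close>

lemma convex_conjugate: "convex_on UNIV conjugate"
proof (rule convex_onI)
  fix t :: real and x y :: 'a
  assume t: "0 < t" "t < 1"
  define p where "p = argmin ((1 - t) *\<^sub>R x + t *\<^sub>R y)"
  have "conjugate ((1 - t) *\<^sub>R x + t *\<^sub>R y) = (1 - t) * (- tilted x p) + t * (- tilted y p)"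
    unfolding conjugate_def p_def[symmetric] tilted_def inner_add_left inner_scaleR_left
    by (simp add: algebra_simps diff_divide_distrib)
  also have "\<dots> \<le> (1 - t) * conjugate x + t * conjugate y"
    using t by (intro add_mono mult_left_mono conjugate_ge) (auto simp: p_def argmin_in)
  finally show "conjugate ((1 - t) *\<^sub>R x + t *\<^sub>R y) \<le> (1 - t) * conjugate x + t * conjugate y" .
qed simp

text \<open>A Euclidean bound that controls the remainder in the differentiability proof.\<close>

lemma argmin_lipschitz: "\<mu> * norm (argmin w - argmin w') \<le> norm (w - w')"
proof (cases "argmin w = argmin w'")
  case False
  have "\<mu> * (norm (argmin w - argmin w'))\<^sup>2 \<le> norm (w - w') * norm (argmin w - argmin w')"
    using coercive[of "argmin w - argmin w'"] argmin_monotone[of w w']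
      norm_cauchy_schwarz[of "w - w'" "argmin w - argmin w'"] by linarith
  then have "(\<mu> * norm (argmin w - argmin w')) * norm (argmin w - argmin w')
      \<le> norm (w - w') * norm (argmin w - argmin w')"
    by (simp add: power2_eq_square)
  then show ?thesis using False by (subst (asm) mult_le_cancel_right) simp
qed simp

text \<open>An envelope argument: \<open>argmin w\<close> as competitor at \<open>w'\<close> makes
  the remainder nonnegative, and \<open>argmin w'\<close> as competitor at \<open>w\<close> bounds
  it by the square of \<open>norm (w' - w)\<close> over \<open>\<mu>\<close>. This holds globally,
  so the radius 1 is arbitrary.\<close>

lemma GDERIV_conjugate: "GDERIV conjugate w :> argmin w"
  unfolding gderiv_def
proof (rule has_derivativeI_sandwich[of 1])
  show "bounded_linear (\<lambda>h. h \<bullet> argmin w)" by (rule bounded_linear_inner_left)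
  show "norm (conjugate w' - conjugate w - (w' - w) \<bullet> argmin w) / norm (w' - w) \<le> norm (w' - w) / \<mu>"
    if "w' \<noteq> w" for w'
  proof -
    have lo: "0 \<le> conjugate w' - conjugate w - (w' - w) \<bullet> argmin w"
      using conjugate_ge[OF argmin_in, of w' w] by (simp add: conjugate_def[of w] tilted_def inner_diff_left)
    have "conjugate w' - conjugate w - (w' - w) \<bullet> argmin w \<le> (w' - w) \<bullet> (argmin w' - argmin w)"
      using conjugate_ge[OF argmin_in, of w w']
      by (simp add: conjugate_def[of w'] tilted_def inner_diff_left inner_diff_right)
    also have "\<dots> \<le> norm (w' - w) * norm (argmin w' - argmin w)"
      by (rule norm_cauchy_schwarz)
    also have "\<dots> \<le> norm (w' - w) * (norm (w' - w) / \<mu>)"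
      using argmin_lipschitz[of w' w] mu_pos by (intro mult_left_mono) (auto simp: field_simps)
    finally show ?thesis
      using lo that mu_pos by (simp add: divide_simps mult.commute)
  qed
  show "((\<lambda>w'. norm (w' - w) / \<mu>) \<longlongrightarrow> 0) (at w)"
    using mu_pos by (auto intro!: tendsto_eq_intros)
qed simp

end

section \<open>Extended-real-valued convex functions\<close>

text \<open>The Liminf runs over punctured neighbourhoods; the point itself may be added because the
  strict inequality is assumed there.\<close>

lemma lsc_iff_eventually:
  "lsc f \<longleftrightarrow> (\<forall>x C. C < f x \<longrightarrow> (\<forall>\<^sub>F y in nhds x. C < f y))"
  unfolding lsc_def le_Liminf_iff eventually_nhds_conv_at by blast

lemma closed_epigraph_ereal:
  fixes F :: "'a::first_countable_topology \<Rightarrow> ereal"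
  assumes "lsc F" and ninf: "\<And>x. F x \<noteq> -\<infinity>"
  shows "closed (epigraph {x. F x \<noteq> \<infinity>} (\<lambda>x. real_of_ereal (F x)))"
proof -
  have epi: "(x, t) \<in> epigraph {x. F x \<noteq> \<infinity>} (\<lambda>x. real_of_ereal (F x)) \<longleftrightarrow> F x \<le> ereal t" for x t
    using ninf[of x] by (cases "F x") (auto simp: mem_epigraph)
  show ?thesis
    unfolding closed_sequential_limits
  proof (intro allI impI, elim conjE)
    fix X and l :: "'a \<times> real"
    assume X: "\<forall>n. X n \<in> epigraph {x. F x \<noteq> \<infinity>} (\<lambda>x. real_of_ereal (F x))"
      and lim: "X \<longlonglongrightarrow> l"
    have le: "F (fst (X n)) \<le> ereal (snd (X n))" for n
      using X epi[of "fst (X n)" "snd (X n)"] by simp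
    have "F (fst l) \<le> ereal (snd l)"
    proof (rule ccontr)
      assume "\<not> ?thesis"
      then obtain C where C: "ereal (snd l) < C" "C < F (fst l)"
        using dense by (metis not_le)
      have "\<forall>\<^sub>F n in sequentially. C < F (fst (X n))"
        using C(2) \<open>lsc F\<close> tendsto_fst[OF lim]
        by (auto simp: lsc_iff_eventually filterlim_iff)
      moreover have "\<forall>\<^sub>F n in sequentially. ereal (snd (X n)) < C"
        using tendsto_snd[OF lim] C(1) by (intro order_tendstoD(2)[where y = "ereal (snd l)"]) auto
      ultimately have "\<forall>\<^sub>F n in sequentially. False"
        by eventually_elim (use le in \<open>meson less_le_trans less_asym\<close>)
      then show False by simp
    qed
    then show "l \<in> epigraph {x. F x \<noteq> \<infinity>} (\<lambda>x. real_of_ereal (F x))"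
      using epi[of "fst l" "snd l"] by simp
  qed
qed

lemma convex_on_real_of_ereal:
  assumes F: "convex_ereal F" and ninf: "\<And>x. F x \<noteq> -\<infinity>"
  shows "convex_on {x. F x \<noteq> \<infinity>} (\<lambda>x. real_of_ereal (F x))"
proof -
  have *: "F (u *\<^sub>R x + v *\<^sub>R y) \<noteq> \<infinity> \<and>
      real_of_ereal (F (u *\<^sub>R x + v *\<^sub>R y)) \<le> u * real_of_ereal (F x) + v * real_of_ereal (F y)"
    if uv: "u \<ge> 0" "v \<ge> 0" "u + v = 1" and fin: "F x \<noteq> \<infinity>" "F y \<noteq> \<infinity>" for u v x y
  \<comment> \<open>\<open>convex_ereal\<close> speaks of positive weights only.\<close>
  proof (cases "u = 0 \<or> v = 0")
    case True
    then show ?thesis using uv fin by auto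
  next
    case False
    obtain a b where ab: "F x = ereal a" "F y = ereal b"
      using fin ninf by (meson ereal_cases)
    have "F (u *\<^sub>R x + v *\<^sub>R y) \<le> ereal u * F x + ereal v * F y"
      using False uv F unfolding convex_ereal_def by auto
    then show ?thesis
      using ninf[of "u *\<^sub>R x + v *\<^sub>R y"] by (cases "F (u *\<^sub>R x + v *\<^sub>R y)") (auto simp: ab)
  qed
  then show ?thesis unfolding convex_on_def convex_def by auto
qed

lemma lsc_add_Times:
  fixes f :: "'a::topological_space \<Rightarrow> ereal" and h :: "'b::topological_space \<Rightarrow> ereal"
  assumes f: "lsc f" "\<And>x. f x \<noteq> -\<infinity>" and h: "lsc h" "\<And>y. h y \<noteq> -\<infinity>"
  shows "lsc (\<lambda>z. f (fst z) + h (snd z))"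
  unfolding lsc_iff_eventually
proof (intro allI impI)
  fix z :: "'a \<times> 'b" and C :: ereal
  assume C: "C < f (fst z) + h (snd z)"
  show "\<forall>\<^sub>F z' in nhds z. C < f (fst z') + h (snd z')"
  proof (cases C)
    case (real c)
    \<comment> \<open>If both values are finite, each gives up half of the gap above
      \<open>c\<close>; an infinite value makes up for whatever the other one lacks.\<close>
    obtain a b where ab: "ereal a < f (fst z)" "ereal b < h (snd z)" "c \<le> a + b"
    proof (cases "f (fst z)")
      case (real p)
      note p = this
      show ?thesis
      proof (cases "h (snd z)")
        case (real q)
        show ?thesis
          by (rule that[of "p - (p + q - c) / 2" "q - (p + q - c) / 2"])
            (use C p real \<open>C = ereal c\<close> in \<open>auto simp: field_simps\<close>)
      qed (use that[of "p - 1" "c - p + 1"] p h(2) in auto)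
    next
      case PInf
      note p = this
      show ?thesis
      proof (cases "h (snd z)")
        case (real q)
        then show ?thesis using that[of "c - q + 1" "q - 1"] p by auto
      qed (use that[of c 0] p h(2) in auto)
    qed (use f(2) in auto)
    have "\<forall>\<^sub>F z' in nhds z. ereal a < f (fst z')"
      using f(1) ab(1) tendsto_fst[OF filterlim_ident, of z]
      by (auto simp: lsc_iff_eventually filterlim_iff)
    moreover have "\<forall>\<^sub>F z' in nhds z. ereal b < h (snd z')"
      using h(1) ab(2) tendsto_snd[OF filterlim_ident, of z]
      by (auto simp: lsc_iff_eventually filterlim_iff)
    ultimately show ?thesis
    proof eventually_elim
      case (elim z')
      have "ereal c \<le> ereal a + ereal b" using ab(3) by simp
      also have "\<dots> < f (fst z') + h (snd z')"
        using elim by (intro ereal_add_strict_mono2)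
      finally show ?case using real by simp
    qed
  next
    case MInf
    have "-\<infinity> < f (fst z') + h (snd z')" for z'
      using f(2)[of "fst z'"] h(2)[of "snd z'"] by auto
    then show ?thesis using MInf by simp
  qed (use C in auto)
qed

lemma convex_ereal_add_Times:
  assumes f: "convex_ereal f" and h: "convex_ereal h"
  shows "convex_ereal (\<lambda>z. f (fst z) + h (snd z))"
  unfolding convex_ereal_def
proof (intro allI impI)
  fix x y and u v :: real
  assume uv: "u > 0" "v > 0" "u + v = 1"
  have "f (fst (u *\<^sub>R x + v *\<^sub>R y)) + h (snd (u *\<^sub>R x + v *\<^sub>R y))
      \<le> (ereal u * f (fst x) + ereal v * f (fst y)) + (ereal u * h (snd x) + ereal v * h (snd y))"
    using uv f h unfolding convex_ereal_def by (auto intro!: add_mono)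
  also have "\<dots> = ereal u * (f (fst x) + h (snd x)) + ereal v * (f (fst y) + h (snd y))"
    using uv by (simp add: mult.commute[of "ereal _"] distrib_left_ereal_nn add_ac)
  finally show "f (fst (u *\<^sub>R x + v *\<^sub>R y)) + h (snd (u *\<^sub>R x + v *\<^sub>R y)) \<le> \<dots>" .
qed

section \<open>Fenchel conjugates and the affine minorant of F\<close>

lemma fenchel_conjugate_not_MInf:
  assumes "proper g"
  shows "fenchel_conjugate g y \<noteq> -\<infinity>"
proof -
  obtain v c where v: "g v = ereal c"
    using assms unfolding proper_def by (meson ereal_cases)
  have "ereal (v \<bullet> y - c) \<le> fenchel_conjugate g y"
    unfolding fenchel_conjugate_def by (rule SUP_upper2[of v]) (auto simp: v)
  then show ?thesis by auto
qed

lemma lsc_fenchel_conjugate: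
  assumes "proper g"
  shows "lsc (fenchel_conjugate g)"
  unfolding lsc_iff_eventually
proof (intro allI impI)
  fix y C assume "C < fenchel_conjugate g y"
  then obtain v where v: "C < ereal (v \<bullet> y) - g v"
    unfolding fenchel_conjugate_def less_SUP_iff by blast
  \<comment> \<open>\<open>g v = \<infinity>\<close> would make the term -\<infinity>, which exceeds
    no \<open>C\<close>.\<close>
  obtain c where c: "g v = ereal c"
    using assms v unfolding proper_def by (cases "g v") auto
  have "((\<lambda>y'. ereal (v \<bullet> y' - c)) \<longlongrightarrow> ereal (v \<bullet> y - c)) (nhds y)"
    by (intro tendsto_intros filterlim_ident)
  moreover have "C < ereal (v \<bullet> y - c)" using v c by simp
  ultimately have "\<forall>\<^sub>F y' in nhds y. C < ereal (v \<bullet> y' - c)"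
    by (rule order_tendstoD)
  then show "\<forall>\<^sub>F y' in nhds y. C < fenchel_conjugate g y'"
    by eventually_elim (auto simp: fenchel_conjugate_def less_SUP_iff c intro!: exI[of _ v])
qed

lemma convex_ereal_fenchel_conjugate:
  assumes "proper g"
  shows "convex_ereal (fenchel_conjugate g)"
  unfolding convex_ereal_def
proof (intro allI impI)
  fix x y and u v :: real
  assume uv: "u > 0" "v > 0" "u + v = 1"
  let ?R = "ereal u * fenchel_conjugate g x + ereal v * fenchel_conjugate g y"
  have "ereal (w \<bullet> (u *\<^sub>R x + v *\<^sub>R y)) - g w \<le> ?R" for w
  proof (cases "g w")
    case (real c)
    have ge: "ereal (w \<bullet> z - c) \<le> fenchel_conjugate g z" for z
      unfolding fenchel_conjugate_def by (rule SUP_upper2[of w]) (auto simp: real)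
    have "u * c + v * c = c" using uv by (metis distrib_right mult_1)
    then have "ereal (w \<bullet> (u *\<^sub>R x + v *\<^sub>R y)) - g w
        = ereal u * ereal (w \<bullet> x - c) + ereal v * ereal (w \<bullet> y - c)"
      by (simp add: real inner_add_right algebra_simps)
    also have "\<dots> \<le> ?R"
      using uv by (intro add_mono ereal_mult_left_mono ge) auto
    finally show ?thesis .
  qed (use assms in \<open>auto simp: proper_def\<close>)
  then show "fenchel_conjugate g (u *\<^sub>R x + v *\<^sub>R y) \<le> ?R"
    unfolding fenchel_conjugate_def[of g "u *\<^sub>R x + v *\<^sub>R y"] by (rule SUP_least)
qed

text \<open>The two saddle-point inequalities bound \<open>f\<close> and the conjugate of \<open>g\<close> from below by
  affine functions, which replaces the usual appeal to a separation theorem.\<close>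

lemma F_sum_affine_minorant:
  fixes A :: "'a::euclidean_space \<Rightarrow> 'b::euclidean_space"
  assumes f: "proper f" and g: "proper g" and A: "linear A" and S: "saddle_points f g A \<noteq> {}"
  shows "\<exists>a b. \<forall>z. ereal (a \<bullet> z + b) \<le> F_sum f g z"
    and "\<exists>z. F_sum f g z \<noteq> \<infinity>"
proof -
  obtain x y where fin: "f x \<noteq> \<infinity>" "fenchel_conjugate g y \<noteq> \<infinity>"
    and sy: "\<And>y'. lagrangian f g A x y' \<le> lagrangian f g A x y"
    and sx: "\<And>x'. lagrangian f g A x y \<le> lagrangian f g A x' y"
    using S unfolding saddle_points_def by auto
  obtain p where p: "f x = ereal p" using fin f unfolding proper_def by (meson ereal_cases)
  obtain q where q: "fenchel_conjugate g y = ereal q"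
    using fin fenchel_conjugate_not_MInf[OF g] by (meson ereal_cases)
  show "\<exists>z. F_sum f g z \<noteq> \<infinity>"
    by (intro exI[of _ "(x, y)"]) (simp add: F_sum_def p q)
  have F1: "ereal (p + A x \<bullet> y - A x' \<bullet> y) \<le> f x'" for x'
    using sx[of x'] by (cases "f x'") (auto simp: lagrangian_def p q)
  have F2: "ereal (q + A x \<bullet> y' - A x \<bullet> y) \<le> fenchel_conjugate g y'" for y'
    using sy[of y'] by (cases "fenchel_conjugate g y'") (auto simp: lagrangian_def p q)
  \<comment> \<open>The slope is \<open>M_op A (x, y)\<close>: a saddle point is a point where this
    vector is a subgradient of \<open>F\<close>. The constant is \<open>F\<close> at the saddle
    point, since M is skew.\<close>
  have "ereal ((- adjoint A y, A x) \<bullet> z + (p + q)) \<le> F_sum f g z" for z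
  proof -
    have "ereal ((- adjoint A y, A x) \<bullet> z + (p + q))
        = ereal (p + A x \<bullet> y - A (fst z) \<bullet> y) + ereal (q + A x \<bullet> snd z - A x \<bullet> y)"
      by (simp add: inner_prod_def inner_commute[of "adjoint A y"] adjoint_works[OF A])
    also have "\<dots> \<le> F_sum f g z"
      unfolding F_sum_def by (intro add_mono F1 F2)
    finally show ?thesis .
  qed
  then show "\<exists>a b. \<forall>z. ereal (a \<bullet> z + b) \<le> F_sum f g z" by blast
qed

section \<open>Weighted norms and the operator M\<close>

text \<open>Reduces the triangle and Cauchy-Schwarz inequalities for weighted norms to the Euclidean
  ones.\<close>

lemma wnorm_eq_norm_wscale:
  assumes "fst \<beta> \<ge> 0" "snd \<beta> \<ge> 0"
  shows "wnorm \<beta> z = norm (wscale (sqrt (fst \<beta>), sqrt (snd \<beta>)) z)"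
  using assms by (simp add: wnorm_def wscale_def norm_prod_def power_mult_distrib)

lemma wnorm_nonneg: "fst \<beta> \<ge> 0 \<Longrightarrow> snd \<beta> \<ge> 0 \<Longrightarrow> wnorm \<beta> z \<ge> 0"
  by (simp add: wnorm_def)

lemma wnorm_power2:
  assumes "fst \<beta> \<ge> 0" "snd \<beta> \<ge> 0"
  shows "(wnorm \<beta> z)\<^sup>2 = fst \<beta> * (norm (fst z))\<^sup>2 + snd \<beta> * (norm (snd z))\<^sup>2"
  using assms by (simp add: wnorm_def)

lemma wnorm_power2_eq_inner:
  fixes z :: "'a::real_inner \<times> 'b::real_inner"
  assumes "fst \<beta> \<ge> 0" "snd \<beta> \<ge> 0"
  shows "(wnorm \<beta> z)\<^sup>2 = wscale \<beta> z \<bullet> z"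
  using assms by (simp add: wnorm_power2 wscale_def inner_prod_def power2_norm_eq_inner)

lemma wnorm_winv_power2:
  assumes "fst \<beta> > 0" "snd \<beta> > 0"
  shows "(wnorm (winv \<beta>) z)\<^sup>2 = (norm (fst z))\<^sup>2 / fst \<beta> + (norm (snd z))\<^sup>2 / snd \<beta>"
  using assms by (simp add: wnorm_power2 winv_def divide_inverse mult.commute)

lemma wnorm_triangle:
  assumes "fst \<beta> \<ge> 0" "snd \<beta> \<ge> 0"
  shows "wnorm \<beta> (x + y) \<le> wnorm \<beta> x + wnorm \<beta> y"
proof -
  have "wscale (sqrt (fst \<beta>), sqrt (snd \<beta>)) (x + y)
      = wscale (sqrt (fst \<beta>), sqrt (snd \<beta>)) x + wscale (sqrt (fst \<beta>), sqrt (snd \<beta>)) y"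
    by (simp add: wscale_def scaleR_add_right)
  then show ?thesis
    by (simp add: wnorm_eq_norm_wscale[OF assms] norm_triangle_ineq)
qed

lemma wnorm_minus: "wnorm \<beta> (- z) = wnorm \<beta> z"
  by (simp add: wnorm_def)

text \<open>Scaling one argument by the roots of the weights and the other by their inverses leaves
  the inner product unchanged.\<close>

lemma inner_le_wnorm:
  fixes a b :: "'a::real_inner \<times> 'b::real_inner"
  assumes \<beta>: "fst \<beta> > 0" "snd \<beta> > 0"
  shows "a \<bullet> b \<le> wnorm (winv \<beta>) a * wnorm \<beta> b"
proof -
  let ?i = "wscale (sqrt (fst (winv \<beta>)), sqrt (snd (winv \<beta>))) a"
  let ?s = "wscale (sqrt (fst \<beta>), sqrt (snd \<beta>)) b"
  have "a \<bullet> b = ?i \<bullet> ?s"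
    using \<beta> by (simp add: wscale_def winv_def inner_prod_def real_sqrt_inverse)
      (simp add: field_simps)
  also have "\<dots> \<le> norm ?i * norm ?s" by (rule norm_cauchy_schwarz)
  also have "\<dots> = wnorm (winv \<beta>) a * wnorm \<beta> b"
    using \<beta> by (subst (1 2) wnorm_eq_norm_wscale) (auto simp: winv_def)
  finally show ?thesis .
qed

lemma wnorm_wscale_le:
  assumes "fst \<beta> > 0" "snd \<beta> > 0" "fst \<gamma> > 0" "snd \<gamma> > 0"
  shows "wnorm \<gamma> (wscale \<beta> h) \<le> max (fst \<beta> * fst \<gamma>) (snd \<beta> * snd \<gamma>) * wnorm (winv \<gamma>) h"
proof (rule power2_le_imp_le)
  let ?m = "max (fst \<beta> * fst \<gamma>) (snd \<beta> * snd \<gamma>)"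
  have m: "0 \<le> ?m" using assms by (simp add: le_max_iff_disj)
  \<comment> \<open>The products appear because \<gamma> \<beta>^2 = (\<beta> \<gamma>)^2 / \<gamma>
    in each coordinate.\<close>
  have "(fst \<beta> * fst \<gamma>)\<^sup>2 \<le> ?m\<^sup>2" "(snd \<beta> * snd \<gamma>)\<^sup>2 \<le> ?m\<^sup>2"
    using assms by (auto intro!: power_mono)
  then have le: "(fst \<beta> * fst \<gamma>)\<^sup>2 * ((norm (fst h))\<^sup>2 / fst \<gamma>)
      + (snd \<beta> * snd \<gamma>)\<^sup>2 * ((norm (snd h))\<^sup>2 / snd \<gamma>)
      \<le> ?m\<^sup>2 * ((norm (fst h))\<^sup>2 / fst \<gamma>) + ?m\<^sup>2 * ((norm (snd h))\<^sup>2 / snd \<gamma>)"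
    using assms by (intro add_mono mult_right_mono) auto
  have "(wnorm \<gamma> (wscale \<beta> h))\<^sup>2 = (fst \<beta> * fst \<gamma>)\<^sup>2 * ((norm (fst h))\<^sup>2 / fst \<gamma>)
      + (snd \<beta> * snd \<gamma>)\<^sup>2 * ((norm (snd h))\<^sup>2 / snd \<gamma>)"
    using assms by (simp add: wnorm_power2 wscale_def power_mult_distrib)
      (simp add: power2_eq_square)
  also note le
  also have "?m\<^sup>2 * ((norm (fst h))\<^sup>2 / fst \<gamma>) + ?m\<^sup>2 * ((norm (snd h))\<^sup>2 / snd \<gamma>)
      = (?m * wnorm (winv \<gamma>) h)\<^sup>2"
    unfolding power_mult_distrib wnorm_winv_power2[OF assms(3,4)] by (rule distrib_left[symmetric])
  finally show "(wnorm \<gamma> (wscale \<beta> h))\<^sup>2 \<le> (?m * wnorm (winv \<gamma>) h)\<^sup>2" .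
  show "0 \<le> ?m * wnorm (winv \<gamma>) h"
    using m assms by (intro mult_nonneg_nonneg wnorm_nonneg) (auto simp: winv_def)
qed

lemma norm_adjoint_le:
  fixes A :: "'a::euclidean_space \<Rightarrow> 'b::euclidean_space"
  assumes A: "linear A"
  shows "norm (adjoint A y) \<le> onorm A * norm y"
proof (cases "adjoint A y = 0")
  case True
  then show ?thesis
    using onorm_pos_le[of A] A by (simp add: linear_conv_bounded_linear)
next
  case False
  have "norm (adjoint A y) * norm (adjoint A y) = A (adjoint A y) \<bullet> y"
    by (simp add: adjoint_works[OF A, symmetric] norm_eq_sqrt_inner)
  also have "\<dots> \<le> norm (A (adjoint A y)) * norm y" by (rule norm_cauchy_schwarz)
  also have "\<dots> \<le> (onorm A * norm (adjoint A y)) * norm y"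
    using onorm[of A "adjoint A y"] A by (intro mult_right_mono) (auto simp: linear_conv_bounded_linear)
  finally show ?thesis using False by (simp add: mult.assoc mult.left_commute)
qed

section \<open>Skew-symmetry of M and bounds for \<beta> + M and \<beta> - M\<close>

lemma M_op_skew:
  fixes A :: "'a::euclidean_space \<Rightarrow> 'b::euclidean_space"
  assumes A: "linear A"
  shows "M_op A z \<bullet> z' = - (z \<bullet> M_op A z')"
  by (simp add: M_op_def inner_prod_def adjoint_works[OF A] inner_commute[of "adjoint A _"])
    (metis inner_commute)

lemma wscale_symmetric:
  "wscale \<beta> x \<bullet> y = x \<bullet> wscale \<beta> (y :: 'a::real_inner \<times> 'b::real_inner)"
  by (simp add: wscale_def inner_prod_def)

lemma bounded_linear_wscale:
  "bounded_linear (wscale \<beta> :: 'a::real_normed_vector \<times> 'b::real_normed_vector \<Rightarrow> _)"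
  unfolding wscale_def
  by (intro bounded_linear_intros bounded_linear_Pair)

lemma linear_M_op:
  fixes A :: "'a::euclidean_space \<Rightarrow> 'b::euclidean_space"
  assumes A: "linear A"
  shows "linear (M_op A)"
  using A adjoint_linear[OF A]
  by (intro linearI) (simp_all add: M_op_def linear_add linear_cmul)

text \<open>By skew-symmetry of \<open>M\<close> the two cross terms in the square cancel.\<close>

lemma wnorm_M_op_add_wscale:
  fixes A :: "'a::euclidean_space \<Rightarrow> 'b::euclidean_space"
  assumes A: "linear A" and \<beta>: "fst \<beta> > 0" "snd \<beta> > 0"
  shows "(wnorm (winv \<beta>) (M_op A h + wscale \<beta> h))\<^sup>2
    = (wnorm \<beta> h)\<^sup>2 + (wnorm (winv \<beta>) (M_op A h))\<^sup>2"
proof -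
  have c: "snd h \<bullet> A (fst h) = fst h \<bullet> adjoint A (snd h)"
    by (simp add: adjoint_works[OF A] inner_commute)
  have n: "(norm (a + b))\<^sup>2 = (norm a)\<^sup>2 + 2 * (b \<bullet> a) + (norm b)\<^sup>2" for a b :: "'c::real_inner"
    by (simp add: power2_norm_eq_inner inner_add_left inner_add_right inner_commute)
  have m: "(norm (b - a))\<^sup>2 = (norm a)\<^sup>2 - 2 * (b \<bullet> a) + (norm b)\<^sup>2" for a b :: "'c::real_inner"
    by (simp add: power2_norm_eq_inner inner_diff_left inner_diff_right inner_commute)
  show ?thesis
    using \<beta> by (simp add: wnorm_winv_power2 wnorm_power2 M_op_def wscale_def n m c power_mult_distrib)
      (simp add: field_simps power2_eq_square)
qed

text \<open>Separated from \<open>L_const\<close> because its square root bounds each of two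
  operators.\<close>

definition cross_const ::
  "('a::real_normed_vector \<Rightarrow> 'b::real_normed_vector) \<Rightarrow> real \<times> real \<Rightarrow> real \<times> real \<Rightarrow> real" where
  "cross_const A \<beta> \<gamma> =
     max (fst \<beta> * fst \<gamma> + fst \<gamma> / snd \<beta> * (onorm A)\<^sup>2)
         (snd \<beta> * snd \<gamma> + snd \<gamma> / fst \<beta> * (onorm A)\<^sup>2)"

lemma cross_const_nonneg:
  assumes "fst \<beta> > 0" "snd \<beta> > 0" "fst \<gamma> > 0" "snd \<gamma> > 0"
  shows "cross_const A \<beta> \<gamma> \<ge> 0"
  using assms by (simp add: cross_const_def le_max_iff_disj)

text \<open>M exchanges the coordinates, so the x-part of \<open>h\<close> passes through
  \<open>A\<close> into the norm with weight 1 / \<beta>_y. It collects \<beta>_x + |A|^2 /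
  \<beta>_y, and measuring \<open>h\<close> in \<open>winv \<gamma>\<close> multiplies this by
  \<gamma>_x; the y-part is symmetric.\<close>

lemma wnorm_M_op_add_wscale_le:
  fixes A :: "'a::euclidean_space \<Rightarrow> 'b::euclidean_space"
  assumes A: "linear A" and pos: "fst \<beta> > 0" "snd \<beta> > 0" "fst \<gamma> > 0" "snd \<gamma> > 0"
  shows "wnorm (winv \<beta>) (M_op A h + wscale \<beta> h)
    \<le> sqrt (cross_const A \<beta> \<gamma>) * wnorm (winv \<gamma>) h"
proof (rule power2_le_imp_le)
  let ?K = "cross_const A \<beta> \<gamma>" and ?N = "(onorm A)\<^sup>2"
  let ?X = "(norm (fst h))\<^sup>2" and ?Y = "(norm (snd h))\<^sup>2"
  have "(norm (A (fst h)))\<^sup>2 \<le> (onorm A * norm (fst h))\<^sup>2"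
    using onorm[of A "fst h"] A by (intro power_mono) (auto simp: linear_conv_bounded_linear)
  moreover have "(norm (adjoint A (snd h)))\<^sup>2 \<le> (onorm A * norm (snd h))\<^sup>2"
    using norm_adjoint_le[OF A] by (intro power_mono) auto
  ultimately have "(wnorm (winv \<beta>) (M_op A h))\<^sup>2 \<le> ?N * ?Y / fst \<beta> + ?N * ?X / snd \<beta>"
    using pos by (simp add: wnorm_power2 winv_def M_op_def power_mult_distrib divide_inverse_commute add_mono)
  then have "(wnorm (winv \<beta>) (M_op A h + wscale \<beta> h))\<^sup>2
      \<le> (fst \<beta> + ?N / snd \<beta>) * ?X + (snd \<beta> + ?N / fst \<beta>) * ?Y"
    unfolding wnorm_M_op_add_wscale[OF A pos(1,2)]
    using pos by (simp add: wnorm_power2 distrib_right)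
  also have "\<dots> \<le> (?K / fst \<gamma>) * ?X + (?K / snd \<gamma>) * ?Y"
  proof (intro add_mono mult_right_mono)
    show "fst \<beta> + ?N / snd \<beta> \<le> ?K / fst \<gamma>"
      using pos unfolding cross_const_def by (subst pos_le_divide_eq) (auto simp: algebra_simps)
    show "snd \<beta> + ?N / fst \<beta> \<le> ?K / snd \<gamma>"
      using pos unfolding cross_const_def by (subst pos_le_divide_eq) (auto simp: algebra_simps)
  qed auto
  also have "\<dots> = (sqrt ?K * wnorm (winv \<gamma>) h)\<^sup>2"
    using pos cross_const_nonneg[OF pos, of A]
    by (simp add: power_mult_distrib wnorm_power2 winv_def distrib_left divide_inverse)
  finally show "(wnorm (winv \<beta>) (M_op A h + wscale \<beta> h))\<^sup>2 \<le> (sqrt ?K * wnorm (winv \<gamma>) h)\<^sup>2" .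
  show "0 \<le> sqrt ?K * wnorm (winv \<gamma>) h"
    using pos cross_const_nonneg[OF pos, of A]
    by (intro mult_nonneg_nonneg wnorm_nonneg) (auto simp: winv_def)
qed

text \<open>Duality: \<open>\<beta> - M\<close> is the adjoint of \<open>\<beta> + M\<close>.\<close>

lemma wnorm_wscale_diff_M_op_le:
  fixes A :: "'a::euclidean_space \<Rightarrow> 'b::euclidean_space"
  assumes A: "linear A" and pos: "fst \<beta> > 0" "snd \<beta> > 0" "fst \<gamma> > 0" "snd \<gamma> > 0"
  shows "wnorm \<gamma> (wscale \<beta> d - M_op A d) \<le> sqrt (cross_const A \<beta> \<gamma>) * wnorm \<beta> d"
proof -
  define e where "e = wscale \<beta> d - M_op A d"
  let ?k = "sqrt (cross_const A \<beta> \<gamma>)"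
  \<comment> \<open>\<open>wscale \<gamma> e\<close> is the vector that attains the dual norm: its
    pairing with \<open>e\<close> is the square of \<open>wnorm \<gamma> e\<close>, and its own dual
    norm is \<open>wnorm \<gamma> e\<close>.\<close>
  have "(wnorm (winv \<gamma>) (wscale \<gamma> e))\<^sup>2 = (wnorm \<gamma> e)\<^sup>2"
    unfolding wnorm_winv_power2[OF pos(3,4)]
    using pos by (simp add: wnorm_power2 wscale_def power_mult_distrib) (simp add: power2_eq_square)
  then have eq: "wnorm (winv \<gamma>) (wscale \<gamma> e) = wnorm \<gamma> e"
    using pos by (auto intro!: power2_eq_imp_eq wnorm_nonneg simp: winv_def)
  have "(wnorm \<gamma> e)\<^sup>2 = wscale \<gamma> e \<bullet> e"
    using pos by (simp add: wnorm_power2_eq_inner)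
  also have "\<dots> = (M_op A (wscale \<gamma> e) + wscale \<beta> (wscale \<gamma> e)) \<bullet> d"
    unfolding inner_add_left M_op_skew[OF A, of "wscale \<gamma> e"] wscale_symmetric[of \<beta> "wscale \<gamma> e"]
    by (subst (2) e_def) (simp add: inner_diff_right)
  also have "\<dots> \<le> wnorm (winv \<beta>) (M_op A (wscale \<gamma> e) + wscale \<beta> (wscale \<gamma> e)) * wnorm \<beta> d"
    by (rule inner_le_wnorm[OF pos(1,2)])
  also have "\<dots> \<le> (?k * wnorm \<gamma> e) * wnorm \<beta> d"
    using wnorm_M_op_add_wscale_le[OF A pos, of "wscale \<gamma> e"] pos
    unfolding eq by (intro mult_right_mono wnorm_nonneg) auto
  finally have "wnorm \<gamma> e * wnorm \<gamma> e \<le> wnorm \<gamma> e * (?k * wnorm \<beta> d)"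
    by (simp add: power2_eq_square algebra_simps)
  moreover have "0 \<le> ?k * wnorm \<beta> d" "0 \<le> wnorm \<gamma> e"
    using pos cross_const_nonneg[OF pos, of A] by (auto intro!: mult_nonneg_nonneg wnorm_nonneg)
  ultimately show ?thesis
    unfolding e_def[symmetric] by (cases "wnorm \<gamma> e = 0") auto
qed

section \<open>The smoothed function\<close>

lemma gradient_eqI: "GDERIV h z :> d \<Longrightarrow> gradient h z = d"
  unfolding gradient_def
proof (rule the_equality)
  fix d' assume d: "GDERIV h z :> d" and d': "GDERIV h z :> d'"
  have "(\<lambda>h. h \<bullet> d') = (\<lambda>h. h \<bullet> d)"
    using d d' unfolding gderiv_def by (rule has_derivative_unique[rotated])
  then show "d' = d"
    by (metis inner_commute vector_eq_rdot)
qed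

theorem proposition2:
  fixes f :: "real ^ 'n \<Rightarrow> ereal"
    and g :: "real ^ 'm \<Rightarrow> ereal"
    and A :: "real ^ 'n \<Rightarrow> real ^ 'm"
    and \<beta> \<gamma> :: "real \<times> real"
  defines "Fs \<equiv> (\<lambda>z. real_of_ereal (F_star f g A \<beta> z))"
  assumes "proper f" and "lsc f" and "convex_ereal f"
    and "proper g" and "lsc g" and "convex_ereal g"
    and "linear A"
    and "saddle_points f g A \<noteq> {}"
    and "fst \<beta> > 0" and "snd \<beta> > 0" and "fst \<gamma> > 0" and "snd \<gamma> > 0"
  shows "(\<forall>z. \<bar>F_star f g A \<beta> z\<bar> \<noteq> \<infinity>) \<and>
         weakly_convex1 \<beta> Fs \<and>
         (\<forall>z. Fs differentiable (at z)) \<and>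
         (\<forall>z. \<exists>!z'. is_arg_min (zbar_objective f g A \<beta> z) (\<lambda>_. True) z') \<and>
         (\<forall>z. gradient Fs z =
                - M_op A (zbar f g A \<beta> z) + wscale \<beta> (zbar f g A \<beta> z - z)) \<and>
         (\<forall>z1 z2. wnorm \<gamma> (gradient Fs z1 - gradient Fs z2)
                    \<le> L_const A \<beta> \<gamma> * wnorm (winv \<gamma>) (z1 - z2))"
proof -
  note f = \<open>proper f\<close> and g = \<open>proper g\<close> and A = \<open>linear A\<close>
  note pos = \<open>fst \<beta> > 0\<close> \<open>snd \<beta> > 0\<close> \<open>fst \<gamma> > 0\<close> \<open>snd \<gamma> > 0\<close>
  define F where "F = F_sum f g"
  define D where "D = {z. F z \<noteq> \<infinity>}"
  define r where "r = (\<lambda>z. real_of_ereal (F z))"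
  define B :: "(real^'n) \<times> (real^'m) \<Rightarrow> _" where "B = wscale \<beta>"
  define M where "M = M_op A"
  define T where "T = (\<lambda>z. M z + B z)"
  note F_def' = F_def[unfolded F_sum_def[abs_def]]
  have f_ninf: "f x \<noteq> -\<infinity>" for x
    using f by (simp add: proper_def)
  have F_ninf: "F z \<noteq> -\<infinity>" for z
    using f_ninf[of "fst z"] fenchel_conjugate_not_MInf[OF g, of "snd z"] by (simp add: F_def')
  have F_D: "F z = ereal (r z)" if "z \<in> D" for z
    using that F_ninf[of z] by (cases "F z") (auto simp: D_def r_def)
  have F_lsc: "lsc F"
    unfolding F_def' by (intro lsc_add_Times f_ninf fenchel_conjugate_not_MInf lsc_fenchel_conjugate g \<open>lsc f\<close>)
  have F_convex: "convex_ereal F"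
    unfolding F_def' by (intro convex_ereal_add_Times convex_ereal_fenchel_conjugate g \<open>convex_ereal f\<close>)
  have wn: "(wnorm \<beta> z)\<^sup>2 = B z \<bullet> z" for z :: "(real^'n) \<times> (real^'m)"
    using pos by (simp add: B_def wnorm_power2_eq_inner)
  \<comment> \<open>The smaller weight is the best Euclidean coercivity modulus of
    \<open>B\<close>.\<close>
  interpret quadratic_regularisation D r B "min (fst \<beta>) (snd \<beta>)"
  proof (rule quadratic_regularisation.intro)
    show "D \<noteq> {}"
      using F_sum_affine_minorant(2)[OF f g A \<open>saddle_points f g A \<noteq> {}\<close>] by (auto simp: D_def F_def)
    show "convex_on D r"
      unfolding D_def r_def by (rule convex_on_real_of_ereal[OF F_convex F_ninf])
    show "closed (epigraph D r)"
      unfolding D_def r_def by (rule closed_epigraph_ereal[OF F_lsc F_ninf])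
    obtain a b where ab: "\<And>z. ereal (a \<bullet> z + b) \<le> F z"
      using F_sum_affine_minorant(1)[OF f g A \<open>saddle_points f g A \<noteq> {}\<close>] unfolding F_def by blast
    have "a \<bullet> z + b \<le> r z" if "z \<in> D" for z
      using ab[of z] F_D[OF that] by simp
    then show "\<exists>a b. \<forall>z\<in>D. a \<bullet> z + b \<le> r z" by blast
    show "bounded_linear B" unfolding B_def by (rule bounded_linear_wscale)
    show "B x \<bullet> y = x \<bullet> B y" for x y unfolding B_def by (rule wscale_symmetric)
    show "0 < min (fst \<beta>) (snd \<beta>)" using pos by simp
    show "min (fst \<beta>) (snd \<beta>) * (norm x)\<^sup>2 \<le> B x \<bullet> x" for x
    proof -
      have "min (fst \<beta>) (snd \<beta>) * (norm x)\<^sup>2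
          = min (fst \<beta>) (snd \<beta>) * (norm (fst x))\<^sup>2 + min (fst \<beta>) (snd \<beta>) * (norm (snd x))\<^sup>2"
        by (simp add: norm_prod_def distrib_left)
      also have "\<dots> \<le> fst \<beta> * (norm (fst x))\<^sup>2 + snd \<beta> * (norm (snd x))\<^sup>2"
        by (intro add_mono mult_right_mono) auto
      finally show ?thesis using pos by (simp add: wn[symmetric] wnorm_power2)
    qed
  qed
  have skew: "M z \<bullet> z' = - (z \<bullet> M z')" for z z'
    unfolding M_def by (rule M_op_skew[OF A])
  have lin_M: "linear M" unfolding M_def by (rule linear_M_op[OF A])
  have lin_T: "linear T"
    unfolding T_def by (intro linear_compose_add lin_M bounded_linear.linear linear_B)
  have wn_diff: "(wnorm \<beta> (z - z'))\<^sup>2 = B z \<bullet> z - 2 * (B z \<bullet> z') + B z' \<bullet> z'" for z z'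
    unfolding wn B_diff inner_diff_left inner_diff_right using symmetric_B[of z' z]
    by (simp add: inner_commute)
  \<comment> \<open>The cross term of the square joins \<open>M z\<close> to form the tilt
    \<open>T z\<close>; the square of \<open>z\<close> does not depend on \<open>z'\<close> and
    leaves the supremum.\<close>
  have sup_term: "ereal (M z \<bullet> z') - F z' - ereal (1/2 * (wnorm \<beta> (z - z'))\<^sup>2)
      = ereal (- tilted (T z) z' - B z \<bullet> z / 2)" if "z' \<in> D" for z z'
    unfolding wn_diff F_D[OF that] tilted_def T_def by (simp add: inner_add_left field_simps)
  have sup_le: "ereal (M z \<bullet> z') - F z' - ereal (1/2 * (wnorm \<beta> (z - z'))\<^sup>2)
      \<le> ereal (conjugate (T z) - B z \<bullet> z / 2)" for z z'
  proof (cases "z' \<in> D")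
    case True
    then show ?thesis unfolding sup_term[OF True] using conjugate_ge[OF True, of "T z"] by simp
  qed (simp add: D_def)
  have F_star_eq: "F_star f g A \<beta> z = ereal (conjugate (T z) - B z \<bullet> z / 2)" for z
    unfolding F_star_def F_def[symmetric] M_def[symmetric]
    by (intro antisym SUP_least sup_le SUP_upper2[of "argmin (T z)"])
      (simp_all only: sup_term[OF argmin_in] conjugate_def UNIV_I order_refl)
  have Fs_eq: "Fs = (\<lambda>z. conjugate (T z) - B z \<bullet> z / 2)"
    by (simp add: Fs_def F_star_eq)

  have convex: "weakly_convex1 \<beta> Fs"
  proof -
    \<comment> \<open>Half the squared \<beta>-norm in weak convexity cancels the subtracted
      quadratic exactly, so only a convex function of a linear map remains.\<close>
    have "convex_on UNIV (\<lambda>z. conjugate (T z))"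
      using convex_onD[OF convex_conjugate]
      by (intro convex_onI) (simp_all add: linear_add[OF lin_T] linear_cmul[OF lin_T])
    then show ?thesis by (simp add: weakly_convex1_def Fs_eq wn)
  qed

  have obj: "zbar_objective f g A \<beta> z z' = ereal (tilted (T z) z' + B z \<bullet> z / 2)" if "z' \<in> D" for z z'
  proof -
    have "wnorm \<beta> (z' - z) = wnorm \<beta> (z - z')"
      using wnorm_minus[of \<beta> "z' - z"] by simp
    then show ?thesis
      unfolding zbar_objective_def F_def[symmetric] M_def[symmetric]
      by (simp add: wn_diff F_D[OF that] tilted_def T_def inner_add_left field_simps)
  qed
  have obj_inf: "zbar_objective f g A \<beta> z z' = \<infinity>" if "z' \<notin> D" for z z'
    using that by (simp add: zbar_objective_def F_def[symmetric] D_def)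
  \<comment> \<open>On \<open>D\<close> the objective differs from \<open>tilted (T z)\<close> by a
    constant, and off \<open>D\<close> it is infinite. The equivalence yields existence and
    uniqueness and also evaluates the choice in \<open>zbar\<close>.\<close>
  have arg_min_iff: "is_arg_min (zbar_objective f g A \<beta> z) (\<lambda>_. True) z' \<longleftrightarrow> z' = argmin (T z)" for z z'
  proof
    assume "is_arg_min (zbar_objective f g A \<beta> z) (\<lambda>_. True) z'"
    then have le: "zbar_objective f g A \<beta> z z' \<le> zbar_objective f g A \<beta> z (argmin (T z))"
      unfolding is_arg_min_def by (meson not_less)
    then have "z' \<in> D"
      using obj_inf[of z' z] by (cases "z' \<in> D") (auto simp: obj argmin_in)
    then show "z' = argmin (T z)"
      using le by (intro argmin_unique) (simp_all add: obj argmin_in)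
  next
    assume z': "z' = argmin (T z)"
    have "zbar_objective f g A \<beta> z z' \<le> zbar_objective f g A \<beta> z y" for y
      unfolding z' by (cases "y \<in> D") (simp_all add: obj obj_inf argmin_in argmin_le)
    then show "is_arg_min (zbar_objective f g A \<beta> z) (\<lambda>_. True) z'"
      by (simp add: is_arg_min_def not_less)
  qed
  have zbar_eq: "zbar f g A \<beta> z = argmin (T z)" for z
    by (simp add: zbar_def arg_min_def arg_min_iff)

  define G where "G = (\<lambda>z. - M (argmin (T z)) + B (argmin (T z) - z))"
  have grad: "GDERIV Fs z :> G z" for z
    unfolding gderiv_def Fs_eq
  proof (rule has_derivative_eq_rhs)
    show "((\<lambda>z. conjugate (T z) - B z \<bullet> z / 2) has_derivative
        (\<lambda>h. T h \<bullet> argmin (T z) - (B z \<bullet> h + B h \<bullet> z) / 2)) (at z)"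
    proof (rule has_derivative_diff)
      have T: "(T has_derivative T) (at z)"
        using lin_T by (simp add: bounded_linear_imp_has_derivative linear_conv_bounded_linear)
      show "((\<lambda>z. conjugate (T z)) has_derivative (\<lambda>h. T h \<bullet> argmin (T z))) (at z)"
        using GDERIV_conjugate[of "T z"] unfolding gderiv_def by (rule has_derivative_compose[OF T])
      have "((\<lambda>z. B z \<bullet> z) has_derivative (\<lambda>h. B z \<bullet> h + B h \<bullet> z)) (at z)"
        by (intro has_derivative_inner bounded_linear_imp_has_derivative linear_B has_derivative_ident)
      then show "((\<lambda>z. B z \<bullet> z / 2) has_derivative (\<lambda>h. (B z \<bullet> h + B h \<bullet> z) / 2)) (at z)"
        by (rule bounded_linear.has_derivative[OF bounded_linear_divide])
    qed
    \<comment> \<open>Moving \<open>T\<close> to the other side turns M into -M and keeps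
      \<open>B\<close>, which explains the sign of M in the gradient.\<close>
    show "(\<lambda>h. T h \<bullet> argmin (T z) - (B z \<bullet> h + B h \<bullet> z) / 2) = (\<lambda>h. h \<bullet> G z)"
    proof
      fix h
      have "B z \<bullet> h + B h \<bullet> z = 2 * (h \<bullet> B z)"
        by (simp add: symmetric_B[of h] inner_commute[of "B z"])
      then show "T h \<bullet> argmin (T z) - (B z \<bullet> h + B h \<bullet> z) / 2 = h \<bullet> G z"
        by (simp add: T_def G_def inner_add_left inner_add_right B_diff inner_diff_right skew[of h]
            symmetric_B[of h])
    qed
  qed
  have gradient: "gradient Fs z = G z" for z
    by (rule gradient_eqI[OF grad])

  have lipschitz: "wnorm \<gamma> (G z1 - G z2) \<le> L_const A \<beta> \<gamma> * wnorm (winv \<gamma>) (z1 - z2)" for z1 z2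
  proof -
    define d where "d = argmin (T z1) - argmin (T z2)"
    define h where "h = z1 - z2"
    let ?K = "cross_const A \<beta> \<gamma>"
    have T_diff: "T z1 - T z2 = M_op A h + wscale \<beta> h"
      unfolding h_def linear_diff[OF lin_T, symmetric] by (simp add: T_def M_def B_def)
    \<comment> \<open>Monotonicity and duality of the two norms; cancelling one factor gives the
      Lipschitz constant 1 of the minimizer.\<close>
    have "(wnorm \<beta> d)\<^sup>2 \<le> wnorm (winv \<beta>) (T z1 - T z2) * wnorm \<beta> d"
      using argmin_monotone[of "T z1" "T z2"] inner_le_wnorm[OF pos(1,2), of "T z1 - T z2" d]
      by (simp add: wn d_def)
    then have "wnorm \<beta> d \<le> wnorm (winv \<beta>) (T z1 - T z2)"
      using wnorm_nonneg[of \<beta> d] wnorm_nonneg[of "winv \<beta>" "T z1 - T z2"] pos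
      by (cases "wnorm \<beta> d = 0") (auto simp: power2_eq_square winv_def)
    also have "\<dots> \<le> sqrt ?K * wnorm (winv \<gamma>) h"
      unfolding T_diff by (rule wnorm_M_op_add_wscale_le[OF A pos])
    finally have d_le: "wnorm \<beta> d \<le> sqrt ?K * wnorm (winv \<gamma>) h" .
    have "wnorm \<gamma> (wscale \<beta> d - M_op A d) \<le> sqrt ?K * wnorm \<beta> d"
      by (rule wnorm_wscale_diff_M_op_le[OF A pos])
    also have "\<dots> \<le> sqrt ?K * (sqrt ?K * wnorm (winv \<gamma>) h)"
      using cross_const_nonneg[OF pos, of A] by (intro mult_left_mono d_le) auto
    finally have 1: "wnorm \<gamma> (wscale \<beta> d - M_op A d) \<le> ?K * wnorm (winv \<gamma>) h"
      using cross_const_nonneg[OF pos, of A] by (simp add: mult.assoc[symmetric])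
    have 2: "wnorm \<gamma> (- wscale \<beta> h) \<le> max (fst \<beta> * fst \<gamma>) (snd \<beta> * snd \<gamma>) * wnorm (winv \<gamma>) h"
      unfolding wnorm_minus by (rule wnorm_wscale_le[OF pos])
    \<comment> \<open>Estimating the two summands separately makes the constant a sum of two
      maxima.\<close>
    have "G z1 - G z2 = (B d - M d) + - B h"
      by (simp add: G_def d_def h_def B_diff linear_diff[OF lin_M])
    then have "G z1 - G z2 = (wscale \<beta> d - M_op A d) + - wscale \<beta> h"
      by (simp add: B_def M_def)
    then have "wnorm \<gamma> (G z1 - G z2) \<le> wnorm \<gamma> (wscale \<beta> d - M_op A d) + wnorm \<gamma> (- wscale \<beta> h)"
      using pos by (simp only:) (rule wnorm_triangle, auto)
    then show ?thesis
      using 1 2 unfolding h_def[symmetric] L_const_def cross_const_def[symmetric]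
      by (simp add: distrib_right)
  qed

  show ?thesis
  proof (intro conjI allI)
    show "\<bar>F_star f g A \<beta> z\<bar> \<noteq> \<infinity>" for z by (simp add: F_star_eq)
    show "weakly_convex1 \<beta> Fs" by (rule convex)
    show "Fs differentiable (at z)" for z
      using grad[of z] unfolding gderiv_def differentiable_def by blast
    show "\<exists>!z'. is_arg_min (zbar_objective f g A \<beta> z) (\<lambda>_. True) z'" for z
      by (simp add: arg_min_iff)
    show "gradient Fs z = - M_op A (zbar f g A \<beta> z) + wscale \<beta> (zbar f g A \<beta> z - z)" for z
      by (simp add: gradient zbar_eq G_def M_def B_def)
    show "wnorm \<gamma> (gradient Fs z1 - gradient Fs z2) \<le> L_const A \<beta> \<gamma> * wnorm (winv \<gamma>) (z1 - z2)" for z1 z2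
      unfolding gradient by (rule lipschitz)
  qed
qed

end
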